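(* For $n\ge 1$ let $\xi^{(n)}_1,\dots,\xi^{(n)}_n$ be the zeros (with multiplicity) of the $n$-th monic (probabilists') Hermite polynomial $H_n$, and for each integer $k\ge 0$ let $M_n(k)=\sum_{j=1}^n\left(\xi^{(n)}_j\right)^k$. Then, for each fixed $k$, $M_n(k)$ is a polynomial in $n$. If $k$ is odd, $M_n(k)=0$. If $k$ is even, this polynomial has degree $\deg_n M_n(k)=\frac k2+1$ in $n$, and the coefficient of $n^{k/2+1}$ in it is the Catalan number $C_{k/2}$; that is, $M_n(k)=C_{k/2}\,n^{k/2+1}+f(n)$, where $C_{k/2}=\frac{1}{k/2+1}\binom{k}{k/2}$ and $f$ is a polynomial (depending on $k$) of degree at most $k/2$.
   Context: The $n$-th monic (probabilists') Hermite polynomial is $H_n(x)=\sum_{k=0}^{\lfloor n/2\rfloor}(-1)^k\binom{n}{2k}(2k-1)!!\,x^{n-2k}$ (with $(-1)!!=1$); equivalently $H_0(x)=1$, $H_1(x)=x$, $H_{n+1}(x)=xH_n(x)-nH_{n-1}(x)$. *)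

theory Defs
  imports Complex_Main
    "HOL-Computational_Algebra.Computational_Algebra"
begin

(* The double factorial (2 k - 1)!! = 1 * 3 * ... * (2 k - 1), indexed by k; the empty
   product gives (-1)!! = 1. *)
definition odd_double_fact :: "nat \<Rightarrow> nat" where
  "odd_double_fact k = (\<Prod>i<k. 2 * i + 1)"

definition hermite_poly :: "nat \<Rightarrow> 'a::comm_ring_1 poly" where
  "hermite_poly n =
     (\<Sum>k\<le>n div 2. monom ((- 1) ^ k * of_nat ((n choose (2 * k)) * odd_double_fact k)) (n - 2 * k))"

(* The zeros are taken over the complex numbers, so that there are n of them, counted with
   multiplicity, by the fundamental theorem of algebra (see size_proots_hermite_poly). *)
definition hermite_power_sum :: "nat \<Rightarrow> nat \<Rightarrow> complex" where
  "hermite_power_sum n k = (\<Sum>\<xi>\<in>#proots (hermite_poly n). \<xi> ^ k)"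

definition catalan :: "nat \<Rightarrow> real" where
  "catalan m = 1 / real (m + 1) * real ((2 * m) choose m)"

lemma coeff_hermite_poly_top: "coeff (hermite_poly n :: 'a::comm_ring_1 poly) n = 1"
proof -
  have "coeff (hermite_poly n :: 'a poly) n =
      (\<Sum>k\<le>n div 2. if k = 0 then 1 else 0)"
    unfolding hermite_poly_def coeff_sum
    by (rule sum.cong) (auto simp: odd_double_fact_def)
  then show ?thesis by simp
qed

lemma degree_hermite_poly: "degree (hermite_poly n :: 'a::comm_ring_1 poly) = n"
proof (rule antisym)
  show "degree (hermite_poly n :: 'a poly) \<le> n"
    unfolding hermite_poly_def
    by (intro degree_sum_le) (auto intro: order.trans[OF degree_monom_le])
  show "n \<le> degree (hermite_poly n :: 'a poly)"
    by (rule le_degree) (simp add: coeff_hermite_poly_top)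
qed

lemma size_proots_hermite_poly: "size (proots (hermite_poly n :: complex poly)) = n"
  by (simp add: size_proots_complex degree_hermite_poly)

end

theory Submission
  imports Defs
begin

text \<open>
  The equation \<open>H'' = x H' - n H\<close> makes the zeros of the Hermite polynomial \<open>H\<close> simple, and at a zero
  \<open>w\<close> it gives \<open>2 \<Sum>\<^sub>z 1 / (w - z) = w\<close>, the sum over the other zeros. Multiplying by
  \<open>w ^ k\<close>, summing over \<open>w\<close> and symmetrising in \<open>w\<close> and \<open>z\<close> gives
  \<open>M (k + 1) = (\<Sum>a<k. M a * M (k - 1 - a)) - k * M (k - 1)\<close> for the power sums. Hence the odd ones vanish,
  the even ones are polynomials in \<open>n\<close>, and their leading coefficients obey the Catalan recurrence.
\<close>

section \<open>The differential equation, coefficient by coefficient\<close>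

lemma coeff_hermite_poly:
  "coeff (hermite_poly n :: 'a::comm_ring_1 poly) m =
     (\<Sum>k\<le>n div 2. if n - 2 * k = m
        then (- 1) ^ k * of_nat ((n choose (2 * k)) * odd_double_fact k) else 0)"
  unfolding hermite_poly_def coeff_sum by (intro sum.cong) simp_all

lemma coeff_hermite_poly_diff:
  assumes "2 * k \<le> n"
  shows "coeff (hermite_poly n :: 'a::comm_ring_1 poly) (n - 2 * k) =
     (- 1) ^ k * of_nat ((n choose (2 * k)) * odd_double_fact k)"
proof -
  have "coeff (hermite_poly n :: 'a poly) (n - 2 * k) =
     (\<Sum>i\<le>n div 2. if i = k
        then (- 1) ^ i * of_nat ((n choose (2 * i)) * odd_double_fact i) else 0)"
    unfolding coeff_hermite_poly using assms by (intro sum.cong if_cong) auto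
  then show ?thesis using assms by simp
qed

text \<open>Subtraction is truncated, so the hypothesis includes \<open>m < n\<close>; every
  exponent \<open>n - 2 * k\<close> that occurs differs from \<open>n\<close> by an even
  number.\<close>

lemma coeff_hermite_poly_odd:
  assumes "odd (n - m)"
  shows "coeff (hermite_poly n :: 'a::comm_ring_1 poly) m = 0"
  unfolding coeff_hermite_poly using assms by (intro sum.neutral) auto

text \<open>Two applications of the absorption identity. This gives the ratio of consecutive nonzero
  Hermite coefficients, up to sign and double factorials.\<close>

lemma choose_Suc_Suc_double:
  "(n - Suc (2 * i)) * (n - 2 * i) * (n choose (2 * i)) =
    (2 * i + 2) * ((2 * i + 1) * (n choose (2 * Suc i)))"
proof -
  have step: "Suc j * (n choose Suc j) = (n - j) * (n choose j)" for j
    by (simp only: binomial_absorb_comp binomial_absorption)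
  have "(2 * i + 2) * ((2 * i + 1) * (n choose (2 * Suc i))) =
      (2 * i + 1) * (Suc (Suc (2 * i)) * (n choose Suc (Suc (2 * i))))"
    by (simp add: algebra_simps)
  also have "\<dots> = (2 * i + 1) * ((n - Suc (2 * i)) * (n choose Suc (2 * i)))"
    by (simp only: step)
  also have "\<dots> = (n - Suc (2 * i)) * (Suc (2 * i) * (n choose Suc (2 * i)))"
    by (simp only: Suc_eq_plus1 ac_simps)
  also have "\<dots> = (n - Suc (2 * i)) * ((n - 2 * i) * (n choose (2 * i)))"
    by (simp only: step)
  finally show ?thesis by (simp add: mult.assoc)
qed

text \<open>This is \<open>H'' = x H' - n H\<close> read off at \<open>x ^ m\<close>. If
  \<open>m < n\<close> and \<open>n - m\<close> is even, both coefficients are explicit; otherwise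
  both sides vanish by parity, by degree, or because \<open>m = n\<close>.\<close>

lemma coeff_hermite_poly_Suc_Suc:
  "of_nat ((m + 1) * (m + 2)) * coeff (hermite_poly n :: 'a::comm_ring_1 poly) (Suc (Suc m)) =
     (of_nat m - of_nat n) * coeff (hermite_poly n) m"
proof (cases "m < n \<and> even (n - m)")
  case True
  then obtain j where j: "n - m = 2 * j" "j > 0" by (metis dvdE zero_less_diff nat_0_less_mult_iff)
  then obtain i where i: "j = Suc i" by (metis gr0_implies_Suc)
  have n: "2 * Suc i \<le> n" and m: "m = n - 2 * Suc i" and m2: "Suc (Suc m) = n - 2 * i"
    and nm: "n = m + 2 * Suc i" and m1: "m + 1 = n - Suc (2 * i)"
    using j i True by auto
  have "(m + 1) * (m + 2) * ((n choose (2 * i)) * odd_double_fact i) =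
     (n - Suc (2 * i)) * (n - 2 * i) * (n choose (2 * i)) * odd_double_fact i"
    using m2 m1 by (simp add: mult.assoc)
  also have "\<dots> = (2 * i + 2) * ((n choose (2 * Suc i)) * odd_double_fact (Suc i))"
    unfolding choose_Suc_Suc_double odd_double_fact_def
    by (simp only: prod.lessThan_Suc ac_simps)
  finally have eq: "(m + 1) * (m + 2) * ((n choose (2 * i)) * odd_double_fact i) =
     (2 * i + 2) * ((n choose (2 * Suc i)) * odd_double_fact (Suc i))" .
  have c2: "coeff (hermite_poly n :: 'a poly) (Suc (Suc m)) =
      (- 1) ^ i * of_nat ((n choose (2 * i)) * odd_double_fact i)"
    unfolding m2 by (rule coeff_hermite_poly_diff) (use n in simp)
  have c0: "coeff (hermite_poly n :: 'a poly) m =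
      (- 1) ^ Suc i * of_nat ((n choose (2 * Suc i)) * odd_double_fact (Suc i))"
    unfolding m by (rule coeff_hermite_poly_diff[OF n])
  \<comment> \<open>This minus sign absorbs the sign change between consecutive
    coefficients.\<close>
  have d: "(of_nat m - of_nat n :: 'a) = - of_nat (2 * i + 2)"
    unfolding nm by simp
  have "of_nat ((m + 1) * (m + 2)) * coeff (hermite_poly n :: 'a poly) (Suc (Suc m)) =
     (- 1) ^ i * of_nat ((m + 1) * (m + 2) * ((n choose (2 * i)) * odd_double_fact i))"
    unfolding c2 of_nat_mult by (simp only: ac_simps)
  also have "\<dots> = (of_nat m - of_nat n) * coeff (hermite_poly n) m"
    unfolding eq c0 d of_nat_mult power_Suc by (simp only: mult_minus_left mult_minus_right mult_1_left ac_simps minus_minus)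
  finally show ?thesis .
next
  case False
  then consider "m > n" | "m = n" | "m < n" "odd (n - m)" by linarith
  then show ?thesis
  proof cases
    case 3
    have "coeff (hermite_poly n :: 'a poly) (Suc (Suc m)) = 0"
    proof (cases "Suc (Suc m) \<le> n")
      case True
      with 3 show ?thesis by (intro coeff_hermite_poly_odd) simp
    qed (simp add: coeff_eq_0 degree_hermite_poly)
    then show ?thesis using 3 by (simp add: coeff_hermite_poly_odd)
  qed (simp_all add: coeff_eq_0 degree_hermite_poly)
qed

lemma hermite_poly_ode:
  "pderiv (pderiv (hermite_poly n :: 'a::{comm_ring_1,ring_no_zero_divisors} poly)) =
     [:0, 1:] * pderiv (hermite_poly n) + [:- of_nat n:] * hermite_poly n"
proof (rule poly_eqI)
  fix m
  have "coeff (pderiv (pderiv (hermite_poly n :: 'a poly))) m =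
      (of_nat m - of_nat n) * coeff (hermite_poly n) m"
    unfolding coeff_hermite_poly_Suc_Suc[symmetric] by (simp add: coeff_pderiv algebra_simps)
  also have "\<dots> = coeff ([:0, 1:] * pderiv (hermite_poly n) + [:- of_nat n:] * hermite_poly n) m"
    by (cases m) (simp_all add: coeff_pderiv algebra_simps)
  finally show "coeff (pderiv (pderiv (hermite_poly n :: 'a poly))) m =
      coeff ([:0, 1:] * pderiv (hermite_poly n) + [:- of_nat n:] * hermite_poly n) m" .
qed

section \<open>Simple zeros and the sum over the other zeros\<close>

text \<open>At a common zero of \<open>p\<close> and \<open>pderiv p\<close>, let
  \<open>pderiv p\<close> have order e > 0. Then \<open>p\<close> has order e + 1, so the right-hand
  side of the equation is divisible by the e-th power of the linear factor, whereas the second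
  derivative has order only e - 1.\<close>

lemma rsquarefree_if_second_order_ode:
  fixes p :: "'a::field_char_0 poly"
  assumes ode: "pderiv (pderiv p) = A * pderiv p + B * p" and "p \<noteq> 0"
  shows "rsquarefree p"
  unfolding rsquarefree_roots
proof (intro allI notI, elim conjE)
  fix a assume root: "poly p a = 0" and root': "poly (pderiv p) a = 0"
  \<comment> \<open>A polynomial with zero derivative is constant, and a constant with a zero is
    0.\<close>
  have p': "pderiv p \<noteq> 0"
    using root \<open>p \<noteq> 0\<close> pderiv_iszero by fastforce
  have p'': "pderiv (pderiv p) \<noteq> 0"
    using root' p' pderiv_iszero by fastforce
  have "[:- a, 1:] ^ order a (pderiv p) dvd p"
    using order_pderiv[OF \<open>p \<noteq> 0\<close> root] by (simp add: order_divides)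
  moreover have "[:- a, 1:] ^ order a (pderiv p) dvd pderiv p"
    by (rule order_1)
  ultimately have "[:- a, 1:] ^ order a (pderiv p) dvd pderiv (pderiv p)"
    unfolding ode by (intro dvd_add dvd_mult)
  then have "order a (pderiv p) \<le> order a (pderiv (pderiv p))"
    using p'' order_divides by blast
  then show False
    using order_pderiv[OF p' root'] by simp
qed

text \<open>Since \<open>1 / 0 = 0\<close>, the term \<open>z = w\<close> does not contribute to the sum, here and below.\<close>
lemma poly_pderiv_pderiv_prod_linear:
  fixes S :: "'a::field set"
  assumes "finite S" "w \<in> S"
  defines "p \<equiv> \<Prod>z\<in>S. [:- z, 1:]"
  shows "poly (pderiv (pderiv p)) w = 2 * poly (pderiv p) w * (\<Sum>z\<in>S. 1 / (w - z))"
proof -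
  define q where "q = (\<Prod>z\<in>S - {w}. [:- z, 1:])"
  have p: "p = [:- w, 1:] * q"
    unfolding p_def q_def using assms by (simp add: prod.remove)
  \<comment> \<open>Differentiating \<open>(x - w) q\<close> gives \<open>q + (x - w) q'\<close> and
    then \<open>2 q' + (x - w) q''\<close>.\<close>
  have p': "poly (pderiv p) w = poly q w" and p'': "poly (pderiv (pderiv p)) w = 2 * poly (pderiv q) w"
    unfolding p by (simp_all add: pderiv_mult pderiv_pCons pderiv_add pderiv_diff del: mult_pCons_left)
  have "poly (pderiv q) w = (\<Sum>z\<in>S - {w}. \<Prod>y\<in>S - {w} - {z}. w - y)"
    unfolding q_def pderiv_prod poly_sum by (simp add: poly_prod pderiv_pCons)
  also have "\<dots> = (\<Sum>z\<in>S - {w}. poly q w * (1 / (w - z)))"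
  proof (rule sum.cong)
    fix z assume z: "z \<in> S - {w}"
    have "poly q w = (w - z) * (\<Prod>y\<in>S - {w} - {z}. w - y)"
      unfolding q_def poly_prod using z assms by (simp add: prod.remove[of "S - {w}" z])
    then show "(\<Prod>y\<in>S - {w} - {z}. w - y) = poly q w * (1 / (w - z))"
      using z by auto
  qed simp
  also have "\<dots> = poly q w * (\<Sum>z\<in>S. 1 / (w - z))"
    using assms by (simp add: sum.remove[of S w] sum_distrib_left)
  finally show ?thesis unfolding p' p'' by simp
qed

section \<open>The recurrence for power sums\<close>

lemma power_sum_recurrence:
  fixes S :: "'a::field_char_0 set"
  assumes "finite S" and eq: "\<And>w. w \<in> S \<Longrightarrow> w = 2 * (\<Sum>z\<in>S. 1 / (w - z))"
  defines "M \<equiv> \<lambda>k. \<Sum>w\<in>S. w ^ k"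
  shows "M (Suc k) = (\<Sum>a<k. M a * M (k - Suc a)) - of_nat k * M (k - 1)"
proof -
  define T where "T = (\<Sum>w\<in>S. \<Sum>z\<in>S. w ^ k / (w - z))"
  have "M (Suc k) = (\<Sum>w\<in>S. w ^ k * (2 * (\<Sum>z\<in>S. 1 / (w - z))))"
    unfolding M_def power_Suc2 by (intro sum.cong refl arg_cong2[where f = "(*)"] eq)
  also have "\<dots> = T + T"
    unfolding T_def by (simp add: sum_distrib_left sum.distrib[symmetric] mult.commute)
  \<comment> \<open>Exchange the roles of \<open>w\<close> and \<open>z\<close> in the second copy
    of \<open>T\<close>.\<close>
  also have "\<dots> = T + (\<Sum>w\<in>S. \<Sum>z\<in>S. z ^ k / (z - w))"
    unfolding T_def by (subst (2) sum.swap) simp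
  also have "\<dots> = (\<Sum>w\<in>S. \<Sum>z\<in>S. w ^ k / (w - z) + z ^ k / (z - w))"
    unfolding T_def by (simp add: sum.distrib)
  \<comment> \<open>Off the diagonal this is the divided difference of the k-th power. On the
    diagonal the left side is 0, as \<open>1 / 0 = 0\<close>, but the inner sum is
    \<open>k * w ^ (k - 1)\<close>; removing it produces the term
    \<open>k * M (k - 1)\<close>.\<close>
  also have "\<dots> = (\<Sum>w\<in>S. \<Sum>z\<in>S. (\<Sum>a<k. w ^ a * z ^ (k - Suc a)) -
      (if z = w then of_nat k * w ^ (k - 1) else 0))"
  proof (intro sum.cong refl)
    fix w z :: 'a
    show "w ^ k / (w - z) + z ^ k / (z - w) = (\<Sum>a<k. w ^ a * z ^ (k - Suc a)) -
      (if z = w then of_nat k * w ^ (k - 1) else 0)"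
    proof (cases "z = w")
      case True
      have "(\<Sum>a<k. w ^ a * w ^ (k - Suc a)) = (\<Sum>a<k. w ^ (k - 1))"
        by (intro sum.cong) (auto simp flip: power_add)
      then show ?thesis unfolding True by simp
    next
      case False
      have "w ^ k / (w - z) + z ^ k / (z - w) = (w ^ k - z ^ k) / (w - z)"
        using False by (simp add: divide_simps) (simp add: algebra_simps)
      also have "\<dots> = (\<Sum>a<k. w ^ a * z ^ (k - Suc a))"
        unfolding power_diff_sumr2 using False by (simp add: mult.commute)
      finally show ?thesis using False by simp
    qed
  qed
  also have "\<dots> = (\<Sum>w\<in>S. \<Sum>z\<in>S. \<Sum>a<k. w ^ a * z ^ (k - Suc a)) - of_nat k * M (k - 1)"
    unfolding M_def using \<open>finite S\<close> by (simp add: sum_subtractf sum_distrib_left)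
  also have "(\<Sum>w\<in>S. \<Sum>z\<in>S. \<Sum>a<k. w ^ a * z ^ (k - Suc a)) =
      (\<Sum>w\<in>S. \<Sum>a<k. \<Sum>z\<in>S. w ^ a * z ^ (k - Suc a))"
    by (intro sum.cong refl sum.swap)
  also have "\<dots> = (\<Sum>a<k. \<Sum>w\<in>S. \<Sum>z\<in>S. w ^ a * z ^ (k - Suc a))"
    by (rule sum.swap)
  also have "\<dots> = (\<Sum>a<k. M a * M (k - Suc a))"
    unfolding M_def by (simp add: sum_product)
  finally show ?thesis .
qed

section \<open>Power sums of the Hermite zeros\<close>

lemma hermite_power_sum_0: "hermite_power_sum n 0 = of_nat n"
  by (simp add: hermite_power_sum_def size_proots_hermite_poly)

lemma hermite_power_sum_Suc:
  "hermite_power_sum n (Suc k) =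
     (\<Sum>a<k. hermite_power_sum n a * hermite_power_sum n (k - Suc a)) -
     of_nat k * hermite_power_sum n (k - 1)"
proof -
  define H :: "complex poly" where "H = hermite_poly n"
  define S where "S = {z. poly H z = 0}"
  have "lead_coeff H = 1"
    by (simp add: H_def degree_hermite_poly coeff_hermite_poly_top)
  then have "H \<noteq> 0" by auto
  then have "finite S"
    unfolding S_def by (rule poly_roots_finite)
  have ode: "pderiv (pderiv H) = [:0, 1:] * pderiv H + [:- of_nat n:] * H"
    unfolding H_def by (rule hermite_poly_ode)
  have sqf: "rsquarefree H"
    by (rule rsquarefree_if_second_order_ode[OF ode \<open>H \<noteq> 0\<close>])
  have H: "H = (\<Prod>z\<in>S. [:- z, 1:])"
    using complex_poly_decompose_rsquarefree[OF sqf] \<open>lead_coeff H = 1\<close> by (simp add: S_def)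
  have "w = 2 * (\<Sum>z\<in>S. 1 / (w - z))" if "w \<in> S" for w
  proof -
    have "poly H w = 0" and "poly (pderiv H) w \<noteq> 0"
      using that sqf by (auto simp: S_def rsquarefree_roots)
    moreover have "poly (pderiv (pderiv H)) w = 2 * poly (pderiv H) w * (\<Sum>z\<in>S. 1 / (w - z))"
      unfolding H by (rule poly_pderiv_pderiv_prod_linear[OF \<open>finite S\<close> that])
    \<comment> \<open>At a zero the differential equation reads \<open>H'' = w H'\<close>; cancel
      the nonzero value of \<open>H'\<close>.\<close>
    ultimately show ?thesis by (simp add: ode)
  qed
  moreover have "hermite_power_sum n j = (\<Sum>w\<in>S. w ^ j)" for j
  proof -
    \<comment> \<open>All zeros are simple, so the sum with multiplicity is a sum over the set
      \<open>S\<close>.\<close>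
    have "proots H = mset_set S"
      by (rule multiset_eqI)
        (use \<open>H \<noteq> 0\<close> \<open>finite S\<close> sqf in \<open>auto simp: S_def count_mset_set' rsquarefree_root_order order_0I\<close>)
    then show ?thesis
      by (simp add: hermite_power_sum_def H_def sum_unfold_sum_mset)
  qed
  ultimately show ?thesis
    using power_sum_recurrence[OF \<open>finite S\<close>] by simp
qed

text \<open>In the recurrence for \<open>j + 1\<close> with \<open>j\<close> even, the two indices
  in each product add up to the odd number \<open>j - 1\<close>, so one of them is odd and its
  factor vanishes by induction.\<close>

lemma hermite_power_sum_odd: "odd k \<Longrightarrow> hermite_power_sum n k = 0"
proof (induction k rule: less_induct)
  case (less k)
  then obtain j where k: "k = Suc j" "even j" by (cases k) auto
  have "(\<Sum>a<j. hermite_power_sum n a * hermite_power_sum n (j - Suc a)) = 0"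
  proof (intro sum.neutral ballI)
    fix a assume "a \<in> {..<j}"
    then show "hermite_power_sum n a * hermite_power_sum n (j - Suc a) = 0"
      using less.IH[of a] less.IH[of "j - Suc a"] k by (cases "odd a") auto
  qed
  \<comment> \<open>For \<open>j = 0\<close> the truncated index is 0, which is even, but the factor
    \<open>j\<close> is 0.\<close>
  moreover have "of_nat j * hermite_power_sum n (j - 1) = 0"
    using less.IH[of "j - 1"] k by (cases "j = 0") auto
  ultimately show ?case
    unfolding k(1) hermite_power_sum_Suc by simp
qed

text \<open>The odd power sums vanish, so only the products with \<open>a = 2 * i\<close> survive in
  the recurrence.\<close>

lemma hermite_power_sum_even:
  "hermite_power_sum n (2 * Suc m) =
     (\<Sum>i\<le>m. hermite_power_sum n (2 * i) * hermite_power_sum n (2 * (m - i))) -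
     of_nat (2 * m + 1) * hermite_power_sum n (2 * m)"
proof -
  let ?M = "hermite_power_sum n"
  have "(\<Sum>a<Suc (2 * m). ?M a * ?M (2 * m - a)) =
      (\<Sum>a\<in>(*) 2 ` {..m}. ?M a * ?M (2 * m - a))"
  proof (rule sum.mono_neutral_right)
    show "\<forall>a\<in>{..<Suc (2 * m)} - (*) 2 ` {..m}. ?M a * ?M (2 * m - a) = 0"
    proof
      fix a assume a: "a \<in> {..<Suc (2 * m)} - (*) 2 ` {..m}"
      then have "odd a" by (auto elim!: evenE)
      then show "?M a * ?M (2 * m - a) = 0" by (simp add: hermite_power_sum_odd)
    qed
  qed auto
  also have "\<dots> = (\<Sum>i\<le>m. ?M (2 * i) * ?M (2 * (m - i)))"
    by (subst sum.reindex) (auto simp: inj_on_def diff_mult_distrib2)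
  finally show ?thesis
    using hermite_power_sum_Suc[of n "Suc (2 * m)"] by simp
qed

section \<open>The even power sums as polynomials in \<open>n\<close>\<close>

text \<open>The recurrence for the even power sums with \<open>n\<close> as the indeterminate,
  started from the power sum of index 0, which is \<open>n\<close>.\<close>

fun even_moment_poly :: "nat \<Rightarrow> real poly" where
  "even_moment_poly 0 = [:0, 1:]"
| "even_moment_poly (Suc m) =
     (\<Sum>i\<le>m. even_moment_poly i * even_moment_poly (m - i)) -
     smult (of_nat (2 * m + 1)) (even_moment_poly m)"

lemma hermite_power_sum_double:
  "hermite_power_sum n (2 * m) = complex_of_real (poly (even_moment_poly m) (real n))"
proof (induction m rule: less_induct)
  case (less m)
  show ?case
  proof (cases m)
    case 0
    then show ?thesis by (simp add: hermite_power_sum_0)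
  next
    case (Suc l)
    show ?thesis
      unfolding Suc hermite_power_sum_even using Suc
      by (simp add: less.IH poly_sum)
  qed
qed

text \<open>With \<open>m = l + 1\<close>, each product has degree at most
  \<open>(i + 1) + (l - i + 1) = m + 1\<close>; the subtracted term has degree at most
  \<open>m\<close>.\<close>

lemma degree_even_moment_poly_le: "degree (even_moment_poly m) \<le> m + 1"
proof (induction m rule: less_induct)
  case (less m)
  show ?case
  proof (cases m)
    case (Suc l)
    have "degree (even_moment_poly i * even_moment_poly (l - i)) \<le> Suc l + 1" if "i \<le> l" for i
      using degree_mult_le[of "even_moment_poly i" "even_moment_poly (l - i)"]
        less.IH[of i] less.IH[of "l - i"] that Suc by linarith
    moreover have "degree (smult (real (2 * l + 1)) (even_moment_poly l)) \<le> Suc l + 1"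
      using degree_smult_le[of "real (2 * l + 1)" "even_moment_poly l"] less.IH[of l] Suc by linarith
    ultimately show ?thesis
      unfolding Suc even_moment_poly.simps by (intro degree_diff_le degree_sum_le) auto
  qed simp
qed

section \<open>Leading coefficients and Catalan numbers\<close>

text \<open>Degree bounds suffice here, so the induction for the top coefficient can run before the
  degrees are known exactly.\<close>

lemma coeff_mult_degree_le:
  assumes "degree p \<le> m" "degree q \<le> n"
  shows "coeff (p * q) (m + n) = coeff p m * coeff q n"
proof -
  have "coeff (p * q) (m + n) = (\<Sum>i\<le>m + n. if i = m then coeff p m * coeff q n else 0)"
    unfolding coeff_mult
  proof (intro sum.cong refl)
    fix i
    consider "i = m" | "i < m" | "i > m" by linarith
    then show "coeff p i * coeff q (m + n - i) = (if i = m then coeff p m * coeff q n else 0)"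
      by cases (use assms in \<open>auto simp: coeff_eq_0\<close>)
  qed
  then show ?thesis by simp
qed

text \<open>These are the coefficients of the generating function
  \<open>(1 - sqrt (1 - 4 x)) / 2\<close>, where \<open>catalan m\<close> belongs to
  \<open>x ^ (m + 1)\<close>. The induction checks that both sides satisfy
  \<open>(m + 2) * C (m + 1) = 2 * (2 * m + 1) * C m\<close>.\<close>

lemma catalan_eq_gbinomial:
  "catalan m = (- 1) ^ m * 2 ^ (2 * m + 1) * ((1 / 2 :: real) gchoose Suc m)"
proof (induction m)
  case 0
  show ?case by (simp add: catalan_def)
next
  case (Suc m)
  have "Suc m * (2 * Suc m choose Suc m) = 2 * (2 * m + 1) * (2 * m choose m)"
  proof -
    have "Suc m * (2 * Suc m choose Suc m) = 2 * (Suc m * (Suc (2 * m) choose m))"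
      using Suc_times_binomial[of m "Suc (2 * m)"] by simp
    also have "Suc (2 * m) choose m = Suc (2 * m) choose Suc m"
      using binomial_symmetric[of m "Suc (2 * m)"] by (simp add: Suc_diff_le)
    also have "Suc m * (Suc (2 * m) choose Suc m) = Suc (2 * m) * (2 * m choose m)"
      by (rule Suc_times_binomial)
    finally show ?thesis by simp
  qed
  then have "real (Suc m) * real (2 * Suc m choose Suc m) =
      2 * (2 * real m + 1) * real (2 * m choose m)"
    by (metis (no_types, lifting) of_nat_mult of_nat_add of_nat_numeral of_nat_1)
  moreover have "real (2 * m choose m) = real (Suc m) * catalan m"
    by (simp add: catalan_def)
  ultimately have "real (Suc m) * real (2 * Suc m choose Suc m) =
      real (Suc m) * (2 * (2 * real m + 1) * catalan m)"
    by (simp only: ac_simps)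
  then have "real (2 * Suc m choose Suc m) = 2 * (2 * real m + 1) * catalan m"
    by (subst (asm) mult_left_cancel) simp_all
  moreover have "real (2 * Suc m choose Suc m) = (real m + 2) * catalan (Suc m)"
    by (simp add: catalan_def field_simps del: binomial_Suc_Suc mult_Suc_right)
  ultimately have 1: "(real m + 2) * catalan (Suc m) = 2 * (2 * real m + 1) * catalan m"
    by simp
  have "(1 / 2 - (real m + 1)) * ((1 / 2 :: real) gchoose Suc m) =
      (real m + 2) * ((1 / 2 :: real) gchoose Suc (Suc m))"
    using gbinomial_mult_1[of "1 / 2 :: real" "Suc m"] by (simp add: algebra_simps)
  then have 2: "(2 * real m + 1) * ((1 / 2 :: real) gchoose Suc m) =
      - 2 * (real m + 2) * ((1 / 2 :: real) gchoose Suc (Suc m))"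
    by (simp add: algebra_simps)
  have "(real m + 2) * catalan (Suc m) = 2 * (- 1) ^ m * 2 ^ (2 * m + 1) *
     ((2 * real m + 1) * ((1 / 2 :: real) gchoose Suc m))"
    unfolding 1 Suc by simp
  also have "\<dots> = (real m + 2) *
     ((- 1) ^ Suc m * 2 ^ (2 * Suc m + 1) * ((1 / 2 :: real) gchoose Suc (Suc m)))"
    unfolding 2 by (simp add: algebra_simps)
  finally show ?case
    by (subst (asm) mult_left_cancel) simp_all
qed

text \<open>Vandermonde's identity for \<open>1/2 + 1/2 = 1\<close>, as \<open>1 gchoose (m + 2) = 0\<close>.\<close>
lemma catalan_Suc: "catalan (Suc m) = (\<Sum>i\<le>m. catalan i * catalan (m - i))"
proof -
  define b where "b k = ((1 / 2 :: real) gchoose k)" for k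
  have "0 = (\<Sum>k\<le>Suc (Suc m). b k * b (Suc (Suc m) - k))"
    using gbinomial_Vandermonde[of "1 / 2 :: real" "1 / 2" "Suc (Suc m)"]
      binomial_gbinomial[of 1 "Suc (Suc m)", where 'a = real]
    by (simp add: b_def atLeast0AtMost)
  \<comment> \<open>Split off the two end terms; since \<open>b 0 = 1\<close>, each equals
    \<open>b (m + 2)\<close>.\<close>
  also have "\<dots> = b 0 * b (Suc (Suc m)) + ((\<Sum>i\<le>m. b (Suc i) * b (Suc m - i)) + b (Suc (Suc m)) * b 0)"
    by (subst sum.atMost_Suc_shift) simp
  also have "(\<Sum>i\<le>m. b (Suc i) * b (Suc m - i)) = (\<Sum>i\<le>m. b (Suc i) * b (Suc (m - i)))"
    by (intro sum.cong) (auto simp: Suc_diff_le)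
  finally have eq: "(\<Sum>i\<le>m. b (Suc i) * b (Suc (m - i))) = - 2 * b (Suc (Suc m))"
    by (simp add: b_def)
  \<comment> \<open>The signs and powers of 2 of the two factors multiply to a constant independent
    of \<open>i\<close>.\<close>
  have "(\<Sum>i\<le>m. catalan i * catalan (m - i)) =
      (\<Sum>i\<le>m. (- 1) ^ m * 2 ^ (2 * m + 2) * (b (Suc i) * b (Suc (m - i))))"
  proof (intro sum.cong refl)
    fix i assume "i \<in> {..m}"
    then obtain j where m: "m = i + j" by (auto dest: le_Suc_ex)
    show "catalan i * catalan (m - i) = (- 1) ^ m * 2 ^ (2 * m + 2) * (b (Suc i) * b (Suc (m - i)))"
      unfolding m catalan_eq_gbinomial b_def by (simp add: power_add algebra_simps)
  qed
  also have "\<dots> = (- 1) ^ m * 2 ^ (2 * m + 2) * (- 2 * b (Suc (Suc m)))"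
    unfolding sum_distrib_left[symmetric] eq ..
  also have "\<dots> = catalan (Suc m)"
    unfolding catalan_eq_gbinomial b_def by simp
  finally show ?thesis ..
qed

text \<open>At the top position the recurrence becomes the Catalan convolution, because the
  subtracted term has too small a degree to contribute.\<close>

lemma coeff_even_moment_poly: "coeff (even_moment_poly m) (m + 1) = catalan m"
proof (induction m rule: less_induct)
  case (less m)
  show ?case
  proof (cases m)
    case 0
    then show ?thesis by (simp add: catalan_def)
  next
    case (Suc l)
    have "coeff (even_moment_poly i * even_moment_poly (l - i)) (Suc l + 1) =
        catalan i * catalan (l - i)" if "i \<le> l" for i
    proof -
      have "Suc l + 1 = (i + 1) + (l - i + 1)" using that by simp
      then show ?thesis
        using coeff_mult_degree_le[OF degree_even_moment_poly_le[of i] degree_even_moment_poly_le[of "l - i"]]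
          less.IH[of i] less.IH[of "l - i"] Suc that by simp
    qed
    moreover have "coeff (even_moment_poly l) (Suc l + 1) = 0"
      using degree_even_moment_poly_le[of l] by (intro coeff_eq_0) simp
    ultimately show ?thesis
      unfolding Suc even_moment_poly.simps catalan_Suc by (simp add: coeff_sum)
  qed
qed

theorem theorem2:
  fixes k :: nat
  shows "\<exists>p :: real poly.
    (\<forall>n\<ge>1. hermite_power_sum n k = complex_of_real (poly p (real n))) \<and>
    (odd k \<longrightarrow> (\<forall>n\<ge>1. hermite_power_sum n k = 0)) \<and>
    (even k \<longrightarrow>
      degree p = k div 2 + 1 \<and>
      coeff p (k div 2 + 1) = catalan (k div 2) \<and>
      (\<exists>f :: real poly. degree f \<le> k div 2 \<and>
        (\<forall>n\<ge>1. hermite_power_sum n k =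
          complex_of_real (catalan (k div 2) * real n ^ (k div 2 + 1) + poly f (real n)))))"
proof (cases "odd k")
  case True
  then show ?thesis
    \<comment> \<open>For odd \<open>k\<close> the zero polynomial is the witness.\<close>
    by (intro exI[of _ 0]) (simp add: hermite_power_sum_odd)
next
  case False
  then obtain m where k: "k = 2 * m" by (auto elim: evenE)
  define p where "p = even_moment_poly m"
  define f where "f = p - monom (catalan m) (m + 1)"
  have deg_le: "degree p \<le> m + 1" and coeff: "coeff p (m + 1) = catalan m"
    unfolding p_def by (rule degree_even_moment_poly_le coeff_even_moment_poly)+
  \<comment> \<open>A nonzero top coefficient turns the degree bound into an equality.\<close>
  have "catalan m \<noteq> 0" by (simp add: catalan_def)
  then have deg: "degree p = m + 1"
    using deg_le coeff by (intro antisym le_degree) auto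
  have "degree f \<le> m"
  proof (rule degree_le, intro allI impI)
    fix i assume "m < i"
    then consider "i = m + 1" | "i > m + 1" by linarith
    then show "coeff f i = 0"
      using coeff deg by cases (auto simp: f_def coeff_eq_0)
  qed
  moreover have "poly p (real n) = catalan m * real n ^ (m + 1) + poly f (real n)" for n
    by (simp add: f_def poly_monom)
  ultimately show ?thesis
    using k deg coeff hermite_power_sum_double[of _ m, folded p_def]
    by (intro exI[of _ p]) (auto intro!: exI[of _ f])
qed

end
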